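(* Let $\mathcal{H}=([n],E(\mathcal{H}))$ be a hypergraph, $p$ a prime number, and $\boldsymbol{s}=(s_1,\ldots,s_n)$ a positive integer vector, where $1\leq s_i<p$ for each $i\in[n]$. Any proper coloring of the $\boldsymbol{s}$-disjoint general Kneser hypergraph $\operatorname{KG}^p_{\boldsymbol{s}}(\mathcal{H})$ contains some subhypergraph whose vertex set can be partitioned into parts $V_1,\ldots,V_p$ satisfying the following properties: \begin{itemize} \item $\sum_{i=1}^p|V_i|=\operatorname{ecd}^p_{\boldsymbol{s}}(\mathcal{H})$; \item $\{e_1,\ldots,e_p\}$ forms an edge of $\operatorname{KG}^p_{\boldsymbol{s}}(\mathcal{H})$ for each choice of $e_i\in V_i$; \item the values of the $|V_i|$'s differ by at most one, i.e., $\bigl||V_i|-|V_j|\bigr|\leq 1$ for each $i,j\in[p]$; \item for any $j\in[p]$, the vertices in $V_j$ get distinct colors. \end{itemize}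
   Context: $[n]=\{1,\ldots,n\}$. A hypergraph $\mathcal{H}$ is a pair $(V(\mathcal{H}),E(\mathcal{H}))$ where $V(\mathcal{H})$ is a finite set and $E(\mathcal{H})$ is a family of nonempty subsets of $V(\mathcal{H})$. For $N\subseteq V(\mathcal{H})$, $\mathcal{H}[N]$ is the hypergraph with vertex set $N$ and edge set $\{e\in E(\mathcal{H}): e\subseteq N\}$. Let $r\ge 2$ be an integer and $\boldsymbol{s}=(s_1,\ldots,s_n)$ an integer vector with $1\leq s_i<r$. An $r$-(multi-)set $\{N_1,\ldots,N_r\}$ of subsets of $[n]$ is $\boldsymbol{s}$-disjoint if each $i\in[n]$ appears in at most $s_i$ of the sets $N_j$ (counting repetitions); it is equitable if the values $|N_j|$ differ by at most one; it is equitable $\boldsymbol{s}$-disjoint if it is both. The $\boldsymbol{s}$-disjoint general Kneser hypergraph $\operatorname{KG}^r_{\boldsymbol{s}}(\mathcal{H})$ is the $r$-uniform (multi-)hypergraph with vertex set $E(\mathcal{H})$ whose edges are all (multi-)sets $\{e_1,\ldots,e_r\}$ with $e_1,\ldots,e_r\in E(\mathcal{H})$ that are $\boldsymbol{s}$-disjoint (depending on $\boldsymbol{s}$, an edge may be a multiset of size $r$ rather than a set). A proper coloring is an assignment of colors to the vertices such that no edge is monochromatic. The equitable $\boldsymbol{s}$-disjoint $r$-colorability defect of $\mathcal{H}=([n],E(\mathcal{H}))$ is $$\operatorname{ecd}^r_{\boldsymbol{s}}(\mathcal{H})=\sum_{i=1}^n s_i-\max\Bigl\{\sum_{j=1}^r|N_j|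 : N_j\subseteq[n],\ \{N_1,\ldots,N_r\}\text{ is equitable } \boldsymbol{s}\text{-disjoint and } E(\mathcal{H}[N_j])=\varnothing \text{ for each } j\in[r]\Bigr\}.$$
   Formalization: "Partitioned into parts" is read with multiplicity: a vertex e may lie in several V_j, at most s_i of them for each i in e (disjoint if all s_i=1); disjoint parts fail for n=1, E={{1}}, p=3, s_1=2, where ecd=2 but there is one vertex. *)

theory Defs
  imports "HOL-Library.Multiset" "HOL-Computational_Algebra.Primes"
begin

type_synonym 'a hypergraph = "'a set \<times> 'a set set"

definition is_hypergraph :: "'a hypergraph \<Rightarrow> bool" where
  "is_hypergraph H \<longleftrightarrow> finite (fst H) \<and> (\<forall>e\<in>snd H. e \<noteq> {} \<and> e \<subseteq> fst H)"

definition induced :: "'a hypergraph \<Rightarrow> 'a set \<Rightarrow> 'a hypergraph" where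
  "induced H N = (N, {e \<in> snd H. e \<subseteq> N})"

type_synonym 'a multi_hypergraph = "'a set \<times> 'a multiset set"

definition subhypergraph :: "'a multi_hypergraph \<Rightarrow> 'a multi_hypergraph \<Rightarrow> bool" where
  "subhypergraph K G \<longleftrightarrow>
     fst K \<subseteq> fst G \<and> snd K \<subseteq> snd G \<and> (\<forall>M\<in>snd K. set_mset M \<subseteq> fst K)"

definition proper_coloring :: "'a multi_hypergraph \<Rightarrow> ('a \<Rightarrow> 'c) \<Rightarrow> bool" where
  "proper_coloring G c \<longleftrightarrow> (\<forall>M\<in>snd G. \<not> (\<exists>a. \<forall>v\<in>#M. c v = a))"

definition s_disjoint :: "nat \<Rightarrow> 'a set \<Rightarrow> ('a \<Rightarrow> nat) \<Rightarrow> 'a set multiset \<Rightarrow> bool" where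
  "s_disjoint r V s M \<longleftrightarrow>
     size M = r \<and> (\<forall>N\<in>#M. N \<subseteq> V) \<and> (\<forall>i\<in>V. size {#N \<in># M. i \<in> N#} \<le> s i)"

definition equitable :: "'a set multiset \<Rightarrow> bool" where
  "equitable M \<longleftrightarrow> (\<forall>N\<in>#M. \<forall>N'\<in>#M. card N \<le> card N' + 1)"

definition KG :: "nat \<Rightarrow> ('a \<Rightarrow> nat) \<Rightarrow> 'a hypergraph \<Rightarrow> 'a set multi_hypergraph" where
  "KG r s H = (snd H, {M. set_mset M \<subseteq> snd H \<and> s_disjoint r (fst H) s M})"

text \<open>The difference is taken in the integers, so that no truncated subtraction is involved.
  The set under \<open>Max\<close> is finite, and for a hypergraph it contains 0, since no edge is empty.\<close>

definition ecd :: "nat \<Rightarrow> ('a \<Rightarrow> nat) \<Rightarrow> 'a hypergraph \<Rightarrow> int" where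
  "ecd r s H = int (\<Sum>i\<in>fst H. s i) -
     int (Max {(\<Sum>N\<in>#M. card N) | M. s_disjoint r (fst H) s M \<and> equitable M \<and>
                  (\<forall>N\<in>#M. snd (induced H N) = {})})"

text \<open>Edges of \<open>KG r s H\<close> are multisets, so a vertex \<open>e\<close> can be used several times by one
  edge, but never more than \<open>s i\<close> times for any \<open>i \<in> e\<close>. A partition into parts
  \<open>V 1, \<dots>, V r\<close> is understood with the same multiplicities: the parts cover \<open>W\<close>, and
  \<open>e\<close> lies in at most \<open>s i\<close> of them for every \<open>i \<in> e\<close>. Parts may be empty.
  Strict disjointness would be too much in general: for \<open>r = 3\<close>, \<open>H = ({1}, {{1}})\<close> and
  \<open>s 1 = 2\<close>, the only vertex of \<open>KG r s H\<close> is \<open>{1}\<close>, while \<open>ecd r s H = 2\<close>. If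
  \<open>s = 1\<close>, the parts are pairwise disjoint, as the lemma below shows.\<close>

definition multi_partition ::
    "nat \<Rightarrow> ('a \<Rightarrow> nat) \<Rightarrow> 'a set set \<Rightarrow> (nat \<Rightarrow> 'a set set) \<Rightarrow> bool" where
  "multi_partition r s W V \<longleftrightarrow>
     W = (\<Union>j\<in>{1..r}. V j) \<and> (\<forall>e\<in>W. \<forall>i\<in>e. card {j\<in>{1..r}. e \<in> V j} \<le> s i)"

lemma multi_partition_all_one:
  assumes "{} \<notin> W" "\<And>e i. e \<in> W \<Longrightarrow> i \<in> e \<Longrightarrow> s i = 1"
  shows "multi_partition r s W V \<longleftrightarrow>
    W = (\<Union>j\<in>{1..r}. V j) \<and> (\<forall>j\<in>{1..r}. \<forall>k\<in>{1..r}. j \<noteq> k \<longrightarrow> V j \<inter> V k = {})"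
    (is "_ \<longleftrightarrow> ?U \<and> ?D")
proof -
  have key: "(\<forall>i\<in>e. card {j\<in>{1..r}. e \<in> V j} \<le> s i) \<longleftrightarrow>
      (\<forall>j\<in>{1..r}. \<forall>k\<in>{1..r}. e \<in> V j \<longrightarrow> e \<in> V k \<longrightarrow> j = k)" if "e \<in> W" for e
  proof -
    obtain i where "i \<in> e" using \<open>{} \<notin> W\<close> \<open>e \<in> W\<close> by (metis all_not_in_conv)
    then have "(\<forall>i\<in>e. card {j\<in>{1..r}. e \<in> V j} \<le> s i) \<longleftrightarrow>
        card {j\<in>{1..r}. e \<in> V j} \<le> Suc 0"
      using assms(2)[OF \<open>e \<in> W\<close>] by auto
    also have "\<dots> \<longleftrightarrow> (\<forall>j\<in>{1..r}. \<forall>k\<in>{1..r}. e \<in> V j \<longrightarrow> e \<in> V k \<longrightarrow> j = k)"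
      by (subst card_le_Suc0_iff_eq) auto
    finally show ?thesis .
  qed
  show ?thesis
  proof (cases ?U)
    case True
    have "multi_partition r s W V \<longleftrightarrow>
        (\<forall>e\<in>W. \<forall>j\<in>{1..r}. \<forall>k\<in>{1..r}. e \<in> V j \<longrightarrow> e \<in> V k \<longrightarrow> j = k)"
      unfolding multi_partition_def using True key by blast
    also have "\<dots> \<longleftrightarrow> ?D" unfolding True by blast
    finally show ?thesis using True by blast
  qed (simp add: multi_partition_def)
qed

end

(* A signed set A assigns to each sign a < p a set of vertices, with at most s i signs at each i.
   Since s i < p, rotating the signs is a free action of Z_p on the nonempty signed sets, and they
   contain an equivariant image of the N-fold join of Z_p with itself, N = sum of the s i, which is
   (N-2)-connected. Dold's theorem enters in the following combinatorial form: every equivariant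
   map from signed sets to Z_p admits an increasing chain of N signed sets on which consecutive
   signs are distinct.

   The level of a signed set is the size of its largest equitable subfamily. Take the level of A if
   A contains no edge, and otherwise alpha plus the level of the signed set of all colours of edges
   contained in the parts of A, where alpha is the maximum in the definition of ecd. Properness of
   the colouring keeps the action free on the signed sets of colours, so both kinds carry a sign,
   and this sign cannot change along an inclusion unless the level increases. Along the chain the
   level therefore reaches N, and choosing one edge for each selected colour of the last signed set
   gives the parts.

   The chain is found by evaluating, modulo p, a cocycle representing the generator of the
   cohomology of Z_p in degree N-1 on a subdivided hemisphere of the join. *)

theory Submission
  imports Defs "HOL-Number_Theory.Cong"
begin

section \<open>Subdivision and equivariant chains\<close>

fun coboundary :: "('a list \<Rightarrow> int) \<Rightarrow> 'a list \<Rightarrow> int" where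
  "coboundary g [] = 0"
| "coboundary g (x # xs) = g xs - coboundary (\<lambda>ys. g (x # ys)) xs"

lemma coboundary_add: "coboundary (\<lambda>ys. g ys + g' ys) xs = coboundary g xs + coboundary g' xs"
  by (induction g xs arbitrary: g' rule: coboundary.induct) auto

lemma coboundary_minus: "coboundary (\<lambda>ys. - g ys) xs = - coboundary g xs"
  by (induction g xs rule: coboundary.induct) auto

lemma coboundary_diff: "coboundary (\<lambda>ys. g ys - g' ys) xs = coboundary g xs - coboundary g' xs"
  using coboundary_add[of g "\<lambda>ys. - g' ys" xs] by (simp add: coboundary_minus)

lemma coboundary_cmult: "coboundary (\<lambda>ys. a * g ys) xs = a * coboundary g xs"
  by (induction g xs rule: coboundary.induct) (auto simp: algebra_simps)

lemma coboundary_sum: "coboundary (\<lambda>ys. \<Sum>t\<in>T. g t ys) xs = (\<Sum>t\<in>T. coboundary (g t) xs)"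
proof (induction xs arbitrary: g)
  case (Cons x xs)
  then show ?case by (simp add: sum_subtractf)
qed simp

lemma coboundary_map: "coboundary g (map f xs) = coboundary (\<lambda>ys. g (map f ys)) xs"
  by (induction xs arbitrary: g) auto

lemma coboundary_coboundary: "coboundary (coboundary g) xs = 0"
  by (induction xs arbitrary: g) (simp_all add: coboundary_diff)

text \<open>Chains in \<open>subdiv\<close> grow at the end, where the apex is appended. Deleting
  that entry carries the sign of its position.\<close>

lemma coboundary_snoc: "coboundary g (xs @ [x]) = coboundary (\<lambda>ys. g (ys @ [x])) xs + (-1) ^ length xs * g xs"
  by (induction xs arbitrary: g) auto

lemma coboundary_cong_mod:
  assumes "\<And>ys. Suc (length ys) = length xs \<Longrightarrow> set ys \<subseteq> set xs \<Longrightarrow> [g ys = g' ys] (mod m)"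
  shows "[coboundary g xs = coboundary g' xs] (mod m)"
  using assms
proof (induction xs arbitrary: g g')
  case (Cons x xs)
  have "[coboundary (\<lambda>ys. g (x # ys)) xs = coboundary (\<lambda>ys. g' (x # ys)) xs] (mod m)"
    using Cons.prems by (intro Cons.IH) (auto intro!: Cons.prems)
  moreover have "[g xs = g' xs] (mod m)"
    by (rule Cons.prems) auto
  ultimately show ?case by (auto intro: cong_diff)
qed simp

lemma coboundary_cong:
  assumes "\<And>ys. Suc (length ys) = length xs \<Longrightarrow> g ys = g' ys"
  shows "coboundary g xs = coboundary g' xs"
  using coboundary_cong_mod[of xs g g' 0] assms by simp

text \<open>Evaluation of the cochain \<open>w\<close> on the barycentric subdivision of the simplex \<open>xs\<close> with
  \<open>n\<close> vertices: the subdivision is the cone, with apex the barycentre \<open>set xs\<close>, over the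
  subdivided boundary.\<close>

fun subdiv :: "nat \<Rightarrow> ('v set list \<Rightarrow> int) \<Rightarrow> 'v list \<Rightarrow> int" where
  "subdiv 0 w xs = w []"
| "subdiv (Suc n) w xs = (-1) ^ n * coboundary (subdiv n (\<lambda>c. w (c @ [set xs]))) xs"

lemma subdiv_add: "subdiv n (\<lambda>c. w c + w' c) xs = subdiv n w xs + subdiv n w' xs"
proof (induction n arbitrary: w w' xs)
  case (Suc n)
  have "subdiv n (\<lambda>c. w (c @ [X]) + w' (c @ [X])) =
      (\<lambda>ys. subdiv n (\<lambda>c. w (c @ [X])) ys + subdiv n (\<lambda>c. w' (c @ [X])) ys)" for X
    by (rule ext) (rule Suc)
  then show ?case by (simp add: coboundary_add algebra_simps)
qed simp

lemma subdiv_cmult: "subdiv n (\<lambda>c. a * w c) xs = a * subdiv n w xs"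
proof (induction n arbitrary: w xs)
  case (Suc n)
  have "subdiv n (\<lambda>c. a * w (c @ [X])) = (\<lambda>ys. a * subdiv n (\<lambda>c. w (c @ [X])) ys)" for X
    by (rule ext) (rule Suc)
  then show ?case by (simp add: coboundary_cmult)
qed simp

lemma subdiv_diff: "subdiv n (\<lambda>c. w c - w' c) xs = subdiv n w xs - subdiv n w' xs"
  using subdiv_add[of n w "\<lambda>c. - w' c" xs] subdiv_cmult[of n "-1" w' xs] by simp

lemma subdiv_zero: "subdiv n (\<lambda>c. 0) xs = 0"
  using subdiv_cmult[of n 0 "\<lambda>c. 0" xs] by simp

lemma subdiv_sum:
  assumes "finite T"
  shows "subdiv n (\<lambda>c. \<Sum>t\<in>T. w t c) xs = (\<Sum>t\<in>T. subdiv n (w t) xs)"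
  using assms by (induction T rule: finite_induct) (auto simp: subdiv_zero subdiv_add)

text \<open>Only flags of nonempty faces are evaluated. A cochain that vanishes modulo
  \<open>m\<close> on all of them has value 0, which is how a chain of signed sets is found
  later.\<close>

lemma subdiv_cong_mod:
  assumes "length xs = n"
    and "\<And>c. length c = n \<Longrightarrow> sorted_wrt (\<subseteq>) c \<Longrightarrow> \<forall>A\<in>set c. A \<noteq> {} \<and> A \<subseteq> set xs
           \<Longrightarrow> [w c = w' c] (mod m)"
  shows "[subdiv n w xs = subdiv n w' xs] (mod m)"
  using assms
proof (induction n arbitrary: w w' xs)
  case (Suc n)
  have "[subdiv n (\<lambda>c. w (c @ [set xs])) ys = subdiv n (\<lambda>c. w' (c @ [set xs])) ys] (mod m)"
    if "Suc (length ys) = length xs" "set ys \<subseteq> set xs" for ys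
  proof (rule Suc.IH)
    show "length ys = n" using that Suc.prems by simp
    fix c :: "'a set list"
    assume c: "length c = n" "sorted_wrt (\<subseteq>) c" "\<forall>A\<in>set c. A \<noteq> {} \<and> A \<subseteq> set ys"
    have "xs \<noteq> []" using Suc.prems by auto
    then show "[w (c @ [set xs]) = w' (c @ [set xs])] (mod m)"
      using c that by (intro Suc.prems(2)) (auto simp: sorted_wrt_append)
  qed
  then show ?case
    by (auto intro!: cong_mult coboundary_cong_mod)
qed simp

lemma subdiv_cong:
  assumes "length xs = n" "\<And>c. length c = n \<Longrightarrow> w c = w' c"
  shows "subdiv n w xs = subdiv n w' xs"
  using subdiv_cong_mod[of xs n w w' 0] assms by simp

text \<open>Subdivision is a chain map. Faces that keep the apex contribute a coboundary of a
  coboundary, hence nothing; deleting the apex leaves the subdivided boundary, with a sign that the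
  power of -1 in \<open>subdiv\<close> cancels.\<close>

lemma subdiv_coboundary:
  assumes "length xs = Suc n"
  shows "subdiv (Suc n) (coboundary w) xs = coboundary (subdiv n w) xs"
  using assms
proof (induction n arbitrary: w xs)
  case 0
  then show ?case by (cases xs) auto
next
  case (Suc n)
  define u where "u = (\<lambda>c. w (c @ [set xs]))"
  have "subdiv (Suc n) (\<lambda>c. coboundary w (c @ [set xs])) ys = coboundary (subdiv n u) ys + (-1) ^ Suc n * subdiv (Suc n) w ys"
    if "Suc (length ys) = length xs" for ys
  proof -
    have "subdiv (Suc n) (\<lambda>c. coboundary w (c @ [set xs])) ys = subdiv (Suc n) (\<lambda>c. coboundary u c + (-1) ^ Suc n * w c) ys"
      using that Suc.prems by (intro subdiv_cong) (simp_all add: coboundary_snoc u_def del: subdiv.simps)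
    also have "\<dots> = subdiv (Suc n) (coboundary u) ys + (-1) ^ Suc n * subdiv (Suc n) w ys"
      by (simp only: subdiv_add subdiv_cmult)
    also have "subdiv (Suc n) (coboundary u) ys = coboundary (subdiv n u) ys"
      using that Suc.prems by (intro Suc.IH) simp
    finally show ?thesis .
  qed
  then have "coboundary (subdiv (Suc n) (\<lambda>c. coboundary w (c @ [set xs]))) xs =
      coboundary (\<lambda>ys. coboundary (subdiv n u) ys + (-1) ^ Suc n * subdiv (Suc n) w ys) xs"
    by (intro coboundary_cong)
  also have "\<dots> = (-1) ^ Suc n * coboundary (subdiv (Suc n) w) xs"
    by (simp only: coboundary_add coboundary_cmult coboundary_coboundary)
  finally show ?case
    by (subst subdiv.simps(2)) (simp del: subdiv.simps)
qed

lemma subdiv_map: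
  assumes "length xs = n"
    and "\<And>A. A \<noteq> {} \<Longrightarrow> A \<subseteq> set xs \<Longrightarrow> F (r ` A) = r' (F A)"
  shows "subdiv n (\<lambda>c. w (map F c)) (map r xs) = subdiv n (\<lambda>c. w (map r' (map F c))) xs"
  using assms
proof (induction n arbitrary: w xs)
  case (Suc n)
  have ne: "set xs \<noteq> {}" using Suc.prems(1) by auto
  have *: "subdiv n (\<lambda>c. w (map F c @ [F (r ` set xs)])) (map r ys) =
     subdiv n (\<lambda>c. w (map r' (map F c) @ [r' (F (set xs))])) ys"
    if "Suc (length ys) = length xs" "set ys \<subseteq> set xs" for ys
    using that Suc.prems ne
    by (subst Suc.IH[where w = "\<lambda>c. w (c @ [F (r ` set xs)])"]) auto
  \<comment> \<open>Modulus 0 means equality; the congruence rule is used because it supplies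
    \<open>set ys \<subseteq> set xs\<close>.\<close>
  have "[coboundary (\<lambda>ys. subdiv n (\<lambda>c. w (map F c @ [F (r ` set xs)])) (map r ys)) xs =
     coboundary (\<lambda>ys. subdiv n (\<lambda>c. w (map r' (map F c) @ [r' (F (set xs))])) ys) xs] (mod 0)"
    using * by (intro coboundary_cong_mod) simp
  then show ?case by (simp add: coboundary_map)
qed simp

section \<open>Rotation of signs and the periodic resolution\<close>

definition rot :: "nat \<Rightarrow> nat \<Rightarrow> 'a \<times> nat \<Rightarrow> 'a \<times> nat" where
  "rot p t = (\<lambda>(i, a). (i, (a + t) mod p))"

lemma rot_rot: "rot p t (rot p u v) = rot p (t + u) v"
  by (cases v) (simp add: rot_def mod_simps add_ac)

lemma rot_period: "rot p p = rot p 0"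
  by (auto simp: rot_def fun_eq_iff)

text \<open>Multiplication by \<open>\<nu> - 1\<close> in even and by \<open>1 + \<nu> + \<dots> + \<nu>\<^sup>p\<^sup>-\<^sup>1\<close> in odd degrees, for the
  generator \<open>\<nu>\<close> of \<open>Z\<^sub>p\<close>: the differentials of the periodic resolution.\<close>

definition rot_op :: "nat \<Rightarrow> (nat \<Rightarrow> 'a \<Rightarrow> 'a) \<Rightarrow> nat \<Rightarrow> ('a list \<Rightarrow> int) \<Rightarrow> 'a list \<Rightarrow> int" where
  "rot_op p r k g xs = (if even k then g (map (r 1) xs) - g (map (r 0) xs)
                     else (\<Sum>t<p. g (map (r t) xs)))"

lemma rot_op_diff: "rot_op p r k (\<lambda>ys. g ys - g' ys) xs = rot_op p r k g xs - rot_op p r k g' xs"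
  by (simp add: rot_op_def sum_subtractf)

lemma rot_op_coboundary: "rot_op p r k (coboundary g) xs = coboundary (rot_op p r k g) xs"
  by (simp add: rot_op_def[abs_def] coboundary_map coboundary_diff coboundary_sum)

text \<open>(\<nu> - 1)(1 + \<nu> + ... + \<nu>^(p-1)) = \<nu>^p - 1 = 0, by telescoping. The
  neutral element acts as \<open>rot p 0\<close>, which reduces signs modulo \<open>p\<close>, so
  the identity holds for arbitrary signs in \<open>xs\<close>.\<close>

lemma rot_op_rot_op: "rot_op p (rot p) k (rot_op p (rot p) (Suc k) g) xs = 0"
proof -
  have map_rot: "map (rot p t) (map (rot p u) xs) = map (rot p (t + u)) xs" for t u
    by (simp add: rot_rot)
  define G where "G t = g (map (rot p t) xs)" for t
  have "G p = G 0"
    by (simp only: G_def rot_period)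
  then have "(\<Sum>t<p. G (Suc t)) - (\<Sum>t<p. G t) = 0"
    using sum.lessThan_Suc_shift[of G p] by simp
  moreover have "(\<Sum>t<p. G (t + 1)) = (\<Sum>t<p. G (Suc t))" by simp
  ultimately show ?thesis
    unfolding rot_op_def by (simp only: map_rot) (simp add: G_def sum_subtractf)
qed

text \<open>Evaluation on the chain \<open>h\<^sub>k\<close> of the join of \<open>k + 1\<close> copies of \<open>Z\<^sub>p\<close>, where \<open>h\<^bsub>k+1\<^esub>\<close> is the
  cone over \<open>rot_op h\<^sub>k\<close>, so that the boundary of \<open>h\<^bsub>k+1\<^esub>\<close> is \<open>rot_op h\<^sub>k\<close>. The vertex of sign
  \<open>a\<close> in the \<open>k\<close>-th copy is mapped to \<open>(q k, a)\<close>; this collapses \<open>s i\<close> copies of \<open>Z\<^sub>p\<close> onto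
  the \<open>(s i - 1)\<close>-skeleton of the simplex over \<open>i\<close>.\<close>

fun hemisphere :: "nat \<Rightarrow> (nat \<Rightarrow> 'i) \<Rightarrow> nat \<Rightarrow> (('i \<times> nat) list \<Rightarrow> int) \<Rightarrow> int" where
  "hemisphere p q 0 g = g [(q 0, 0)]"
| "hemisphere p q (Suc k) g = hemisphere p q k (rot_op p (rot p) k (\<lambda>xs. g ((q (Suc k), 0) # xs)))"

lemma hemisphere_diff: "hemisphere p q k (\<lambda>xs. g xs - g' xs) = hemisphere p q k g - hemisphere p q k g'"
proof (induction k arbitrary: g g')
  case (Suc k)
  then show ?case by (simp add: rot_op_diff[abs_def])
qed simp

lemma hemisphere_zero: "hemisphere p q k (\<lambda>xs. 0) = 0"
  using hemisphere_diff[of p q k "\<lambda>_. 0" "\<lambda>_. 0"] by simp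

text \<open>The boundary of a cone is its base minus the cone over the boundary of the base. Here
  the base is a cycle, since its boundary carries two consecutive differentials of the
  resolution.\<close>

lemma hemisphere_coboundary: "hemisphere p q (Suc k) (coboundary g) = hemisphere p q k (rot_op p (rot p) k g)"
proof (induction k arbitrary: g)
  case 0
  show ?case by (simp add: rot_op_def)
next
  case (Suc k)
  define u where "u = (\<lambda>xs. g ((q (Suc (Suc k)), 0) # xs))"
  have "rot_op p (rot p) (Suc k) (coboundary u) = coboundary (rot_op p (rot p) (Suc k) u)"
    by (rule ext) (rule rot_op_coboundary)
  then have "hemisphere p q (Suc k) (rot_op p (rot p) (Suc k) (coboundary u)) = 0"
    using Suc[of "rot_op p (rot p) (Suc k) u"] by (simp only: rot_op_rot_op[abs_def] hemisphere_zero)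
  moreover have "hemisphere p q (Suc (Suc k)) (coboundary g) = hemisphere p q (Suc k) (rot_op p (rot p) (Suc k) g)
      - hemisphere p q (Suc k) (rot_op p (rot p) (Suc k) (coboundary u))"
    by (simp only: hemisphere.simps(2)[of p q "Suc k"] coboundary.simps rot_op_diff[abs_def] hemisphere_diff u_def)
  ultimately show ?case by simp
qed

text \<open>All top simplices of the join after the collapse by \<open>q\<close>; for p > 1 the
  simplices of the chain h_k alone would not be invariant under rotation. Cones put their apex in
  front, hence \<open>rev\<close>.\<close>

definition hemisphere_simplices :: "nat \<Rightarrow> (nat \<Rightarrow> 'i) \<Rightarrow> nat \<Rightarrow> ('i \<times> nat) list set" where
  "hemisphere_simplices p q k = {xs. map fst xs = map q (rev [0..<Suc k]) \<and> (\<forall>v\<in>set xs. snd v < p)}"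

lemma hemisphere_simplices_rot: "p > 0 \<Longrightarrow> xs \<in> hemisphere_simplices p q k \<Longrightarrow> map (rot p t) xs \<in> hemisphere_simplices p q k"
  unfolding hemisphere_simplices_def rot_def by (auto simp: case_prod_beta o_def)

lemma hemisphere_simplices_length: "xs \<in> hemisphere_simplices p q k \<Longrightarrow> length xs = Suc k"
  unfolding hemisphere_simplices_def by (auto dest!: arg_cong[of _ _ length])

lemma rot_op_cong_mod:
  assumes "\<And>t. [g (map (r t) xs) = g' (map (r t) xs)] (mod m)"
  shows "[rot_op p r k g xs = rot_op p r k g' xs] (mod m)"
  unfolding rot_op_def using assms by (auto intro!: cong_diff cong_sum)

lemma hemisphere_cong_mod:
  assumes "p > 0" "\<And>xs. xs \<in> hemisphere_simplices p q k \<Longrightarrow> [g xs = g' xs] (mod m)"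
  shows "[hemisphere p q k g = hemisphere p q k g'] (mod m)"
  using assms(2)
proof (induction k arbitrary: g g')
  case 0
  then show ?case using \<open>p > 0\<close> by (simp add: hemisphere_simplices_def)
next
  case (Suc k)
  have "(q (Suc k), 0) # xs \<in> hemisphere_simplices p q (Suc k)" if "xs \<in> hemisphere_simplices p q k" for xs
    using that \<open>p > 0\<close> by (simp add: hemisphere_simplices_def)
  then show ?case
    using Suc.prems \<open>p > 0\<close>
    by (auto intro!: Suc.IH rot_op_cong_mod hemisphere_simplices_rot)
qed

section \<open>Cocycles of the cyclic group\<close>

text \<open>With residues in \<open>{0..<p}\<close>, this is the Bockstein of the cocycle \<open>y - x\<close>: by
  \<open>of_bool_less_mod\<close> below, \<open>p * carry x y z\<close> is the coboundary of \<open>(y - x) mod p\<close>.\<close>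

definition carry :: "int \<Rightarrow> int \<Rightarrow> int \<Rightarrow> int" where
  "carry x y z = of_bool (y < x) + of_bool (z < y) - of_bool (z < x)"

text \<open>Cup product with the 2-cocycle \<open>carry\<close>: the front face
  \<open>[x, y, z]\<close> and the back face share the vertex \<open>z\<close>.\<close>

fun cup :: "(int list \<Rightarrow> int) \<Rightarrow> int list \<Rightarrow> int" where
  "cup F (x # y # z # c) = carry x y z * F (z # c)"
| "cup F _ = 0"

text \<open>Modulo \<open>p\<close> these represent 1, x, y, yx, y^2, ... in the cohomology of Z_p,
  with x of degree 1 and y its Bockstein.\<close>

fun theta :: "nat \<Rightarrow> int list \<Rightarrow> int" where
  "theta 0 = (\<lambda>c. 1)"
| "theta (Suc 0) = (\<lambda>c. last c - hd c)"
| "theta (Suc (Suc k)) = cup (theta k)"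

text \<open>The cochains \<open>eta\<close> are not invariant; they satisfy \<open>\<delta> (eta k) = theta (k + 1)\<close> and
  \<open>rot_op (eta k) = theta k\<close> modulo \<open>p\<close>, which makes the value of \<open>theta k\<close> on \<open>h\<^sub>k\<close>
  independent of \<open>k\<close>.\<close>

fun eta :: "nat \<Rightarrow> int list \<Rightarrow> int" where
  "eta 0 = hd"
| "eta (Suc 0) = (\<lambda>c. of_bool (last c < hd c))"
| "eta (Suc (Suc k)) = cup (eta k)"

lemma length_eq_Suc_Suc_SucE:
  assumes "length c = Suc (Suc (Suc n))"
  obtains x y z d where "c = x # y # z # d" "length d = n"
  using assms by (auto simp: length_Suc_conv)

text \<open>Leibniz rule: \<open>carry\<close> has degree 2 and is a cocycle, so only the coboundary
  of \<open>F\<close> survives, without a sign.\<close>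

lemma coboundary_cup:
  assumes "length c = Suc (Suc (Suc (Suc n)))"
  shows "coboundary (cup F) c = cup (coboundary F) c"
proof -
  obtain x y z v where c: "c = x # y # z # v" "length v = Suc n"
    using length_eq_Suc_Suc_SucE[OF assms] .
  then obtain w d where v: "v = w # d" by (cases v) auto
  have "carry y z w - carry x z w + carry x y w = carry x y z"
    by (simp add: carry_def)
  moreover have "coboundary (cup F) c = (carry y z w - carry x z w + carry x y w) * F v
      - carry x y z * coboundary (\<lambda>ys. F (z # ys)) v"
    by (simp add: c coboundary_cmult del: v) (simp add: v algebra_simps)
  ultimately show ?thesis
    by (simp add: c algebra_simps)
qed

lemma coboundary_eta:
  assumes "length c = Suc (Suc k)"
  shows "coboundary (eta k) c = theta (Suc k) c"
  using assms
proof (induction k arbitrary: c rule: theta.induct)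
  case 1
  then show ?case by (auto simp: length_Suc_conv)
next
  case 2
  then show ?case by (auto simp: length_Suc_conv carry_def)
next
  case (3 k)
  obtain x y z d where c: "c = x # y # z # d" "length d = Suc k"
    using length_eq_Suc_Suc_SucE 3 by blast
  have "coboundary (eta (Suc (Suc k))) c = cup (coboundary (eta k)) c"
    using 3 by (simp add: coboundary_cup)
  also have "\<dots> = cup (theta (Suc k)) c"
    using c 3 by (simp del: coboundary.simps)
  finally show ?case by simp
qed

text \<open>The cochains are normalised: \<open>carry x y z\<close> vanishes if x = y or y =
  z.\<close>

lemma theta_distinct_adj:
  assumes "length c = Suc k" "theta k c \<noteq> 0"
  shows "distinct_adj c"
  using assms
proof (induction k arbitrary: c rule: theta.induct)
  case (3 k)
  obtain x y z d where c: "c = x # y # z # d" "length d = k"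
    using length_eq_Suc_Suc_SucE 3 by blast
  with 3 have "carry x y z \<noteq> 0" "distinct_adj (z # d)" by auto
  then show ?case by (auto simp: c carry_def)
qed (auto simp: length_Suc_conv)

section \<open>Translation of residues modulo p\<close>

definition shift :: "nat \<Rightarrow> nat \<Rightarrow> int \<Rightarrow> int" where
  "shift p t x = (x + int t) mod int p"

lemma of_bool_less_mod:
  fixes x y p :: int
  assumes "0 \<le> x" "x < p" "0 \<le> y" "y < p"
  shows "p * of_bool (y < x) = (y - x) mod p - (y - x)"
proof (cases "y < x")
  case True
  then have "(y - x + p) mod p = y - x + p" using assms by (intro mod_pos_pos_trivial) auto
  then show ?thesis using True by simp
qed (use assms in auto)

text \<open>Single comparisons of residues are not preserved by a translation, but
  \<open>p * carry x y z\<close> is a combination of differences reduced modulo \<open>p\<close>,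
  and these are.\<close>

lemma carry_shift:
  assumes "p > 0" "set [x, y, z] \<subseteq> {0..<int p}"
  shows "carry (shift p t x) (shift p t y) (shift p t z) = carry x y z"
proof -
  have *: "int p * carry x y z = (y - x) mod int p + (z - y) mod int p - (z - x) mod int p"
    if "set [x, y, z] \<subseteq> {0..<int p}" for x y z
    using that of_bool_less_mod[of x "int p" y] of_bool_less_mod[of y "int p" z]
      of_bool_less_mod[of x "int p" z]
    by (simp add: carry_def algebra_simps)
  have "(shift p t y - shift p t x) mod int p = (y - x) mod int p" for x y
    by (simp add: shift_def mod_simps)
  moreover have "set [shift p t x, shift p t y, shift p t z] \<subseteq> {0..<int p}"
    using \<open>p > 0\<close> by (simp add: shift_def)
  ultimately have "int p * carry (shift p t x) (shift p t y) (shift p t z) = int p * carry x y z"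
    using *[OF assms(2)] *[of "shift p t x" "shift p t y" "shift p t z"] by simp
  then show ?thesis using \<open>p > 0\<close> by simp
qed

lemma sum_shift:
  assumes "p > 0"
  shows "(\<Sum>t<p. shift p t x) = (\<Sum>t<p. int t)"
proof (rule sum.reindex_bij_witness[of _ "\<lambda>u. nat ((int u - x) mod int p)" "\<lambda>t. nat (shift p t x)"])
  fix t assume "t \<in> {..<p}"
  then show "nat ((int (nat (shift p t x)) - x) mod int p) = t"
    using assms by (simp add: shift_def mod_simps)
  show "nat (shift p t x) \<in> {..<p}"
    using assms by (simp add: shift_def nat_less_iff)
  show "int (nat (shift p t x)) = shift p t x"
    using assms by (simp add: shift_def)
next
  fix u assume "u \<in> {..<p}"
  then show "nat (shift p (nat ((int u - x) mod int p)) x) = u"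
    using assms by (simp add: shift_def mod_simps)
  show "nat ((int u - x) mod int p) \<in> {..<p}"
    using assms by (simp add: nat_less_iff)
qed

text \<open>In degree 0, translation by 1 adds 1. In degree 1, the number of translations that put y
  below x is the residue of y - x. Higher up, the invariant factor \<open>carry\<close> comes out,
  and removing it keeps the parity of the degree.\<close>

lemma rot_op_eta:
  assumes "p > 0" "length c = Suc k" "set c \<subseteq> {0..<int p}"
  shows "[rot_op p (shift p) k (eta k) c = theta k c] (mod int p)"
  using assms(2,3)
proof (induction k arbitrary: c rule: theta.induct)
  case 1
  then obtain x where c: "c = [x]" by (auto simp: length_Suc_conv)
  show ?case
    by (simp add: c rot_op_def shift_def cong_def mod_simps)
next
  case 2
  then obtain x y where c: "c = [x, y]" by (auto simp: length_Suc_conv)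
  have sh: "0 \<le> shift p t z" "shift p t z < int p" for t z
    using \<open>p > 0\<close> by (simp_all add: shift_def)
  \<comment> \<open>The residue of y - x is the same for every translate, while the translates of x
    and of y have equal sums.\<close>
  have "int p * (\<Sum>t<p. of_bool (shift p t y < shift p t x)) =
      (\<Sum>t<p. (y - x) mod int p - (shift p t y - shift p t x))"
    unfolding sum_distrib_left
    by (intro sum.cong refl, subst of_bool_less_mod) (simp_all add: sh, simp add: shift_def mod_simps)
  also have "\<dots> = int p * ((y - x) mod int p)"
    using \<open>p > 0\<close> by (simp add: sum_subtractf sum_shift)
  finally have "(\<Sum>t<p. of_bool (shift p t y < shift p t x)) = (y - x) mod int p"
    using \<open>p > 0\<close> by simp
  then show ?case
    by (simp add: c rot_op_def cong_def)
next
  case (3 k)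
  obtain x y z d where c: "c = x # y # z # d" "length d = k"
    using length_eq_Suc_Suc_SucE 3 by blast
  have *: "carry (shift p t x) (shift p t y) (shift p t z) = carry x y z" for t
    using c 3 by (intro carry_shift \<open>p > 0\<close>) auto
  have "rot_op p (shift p) (Suc (Suc k)) (eta (Suc (Suc k))) c =
      carry x y z * rot_op p (shift p) k (eta k) (z # d)"
    by (simp only: rot_op_def c list.map eta.simps cup.simps *)
       (simp add: sum_distrib_left right_diff_distrib)
  moreover have "[rot_op p (shift p) k (eta k) (z # d) = theta k (z # d)] (mod int p)"
    using 3 c by auto
  ultimately show ?case
    using c by (auto intro: cong_mult)
qed

section \<open>Evaluation of the cocycles on the subdivided hemisphere\<close>

lemma rot_op_subdiv:
  assumes "length xs = n"
    and "\<And>A t. A \<noteq> {} \<Longrightarrow> A \<subseteq> set xs \<Longrightarrow> F (r t ` A) = r' t (F A)"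
  shows "rot_op p r k (subdiv n (\<lambda>c. w (map F c))) xs = subdiv n (\<lambda>c. rot_op p r' k w (map F c)) xs"
proof -
  have "subdiv n (\<lambda>c. w (map F c)) (map (r t) xs) = subdiv n (\<lambda>c. w (map (r' t) (map F c))) xs" for t
    by (rule subdiv_map) (use assms in auto)
  then show ?thesis
    by (cases "even k") (simp_all only: rot_op_def if_True if_False subdiv_diff subdiv_sum finite_lessThan)
qed

text \<open>Induction on \<open>k\<close>: \<open>theta (Suc k)\<close> is the coboundary of
  \<open>eta k\<close>, the boundary of the hemisphere is \<open>rot_op\<close> of the previous one,
  and equivariance of \<open>F\<close> passes \<open>rot_op\<close> on to \<open>eta k\<close>,
  which gives \<open>theta k\<close>. In degree 0 the value is 1.\<close>

lemma hemisphere_subdiv_theta: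
  assumes "p > 0"
    and range: "\<And>A. F A \<in> {0..<int p}"
    and equi: "\<And>xs A t. xs \<in> hemisphere_simplices p q k \<Longrightarrow> A \<noteq> {} \<Longrightarrow> A \<subseteq> set xs
                 \<Longrightarrow> F (rot p t ` A) = shift p t (F A)"
  shows "[hemisphere p q k (subdiv (Suc k) (\<lambda>c. theta k (map F c))) = 1] (mod int p)"
  using equi
proof (induction k)
  case 0
  show ?case by simp
next
  case (Suc k)
  \<comment> \<open>Equivariance is assumed below top simplices; a lower simplex is completed to one
    by a vertex of sign 0.\<close>
  have ex: "\<exists>ys\<in>hemisphere_simplices p q (Suc k). set xs \<subseteq> set ys" if "xs \<in> hemisphere_simplices p q k" for xs
    using that \<open>p > 0\<close> by (intro bexI[of _ "(q (Suc k), 0) # xs"]) (auto simp: hemisphere_simplices_def)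
  have equi: "F (rot p t ` A) = shift p t (F A)"
    if "xs \<in> hemisphere_simplices p q k" "A \<noteq> {}" "A \<subseteq> set xs" for xs A t
    using ex[OF that(1)] that Suc.prems by blast
  let ?g = "subdiv (Suc k) (\<lambda>c. eta k (map F c))"
  have "[hemisphere p q (Suc k) (subdiv (Suc (Suc k)) (\<lambda>c. theta (Suc k) (map F c))) =
      hemisphere p q (Suc k) (coboundary ?g)] (mod int p)"
  proof (rule hemisphere_cong_mod[OF \<open>p > 0\<close>])
    fix xs assume "xs \<in> hemisphere_simplices p q (Suc k)"
    then have len: "length xs = Suc (Suc k)" by (rule hemisphere_simplices_length)
    have "subdiv (Suc (Suc k)) (\<lambda>c. theta (Suc k) (map F c)) xs =
        subdiv (Suc (Suc k)) (coboundary (\<lambda>c. eta k (map F c))) xs"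
      using len by (intro subdiv_cong) (simp_all add: coboundary_eta flip: coboundary_map)
    also have "\<dots> = coboundary ?g xs"
      using len by (rule subdiv_coboundary)
    finally show "[subdiv (Suc (Suc k)) (\<lambda>c. theta (Suc k) (map F c)) xs = coboundary ?g xs] (mod int p)"
      by simp
  qed
  also have "hemisphere p q (Suc k) (coboundary ?g) = hemisphere p q k (rot_op p (rot p) k ?g)"
    by (rule hemisphere_coboundary)
  also have "[\<dots> = hemisphere p q k (subdiv (Suc k) (\<lambda>c. theta k (map F c)))] (mod int p)"
  proof (rule hemisphere_cong_mod[OF \<open>p > 0\<close>])
    fix xs assume xs: "xs \<in> hemisphere_simplices p q k"
    then have len: "length xs = Suc k" by (rule hemisphere_simplices_length)
    have "rot_op p (rot p) k ?g xs = subdiv (Suc k) (\<lambda>c. rot_op p (shift p) k (eta k) (map F c)) xs"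
      using len equi[OF xs] by (rule rot_op_subdiv)
    also have "[\<dots> = subdiv (Suc k) (\<lambda>c. theta k (map F c)) xs] (mod int p)"
      using range len by (intro subdiv_cong_mod rot_op_eta \<open>p > 0\<close>) auto
    finally show "[rot_op p (rot p) k ?g xs = subdiv (Suc k) (\<lambda>c. theta k (map F c)) xs] (mod int p)" .
  qed
  also have "[hemisphere p q k (subdiv (Suc k) (\<lambda>c. theta k (map F c))) = 1] (mod int p)"
    using equi by (rule Suc.IH)
  finally show ?case .
qed

text \<open>If every flag had two equal adjacent signs, \<open>theta k\<close> would vanish on all
  flags, against its value 1 modulo \<open>p\<close> on the hemisphere.\<close>

theorem equivariant_sign_chain:
  fixes F :: "('i \<times> nat) set \<Rightarrow> int"
  assumes "p > 1"
    and range: "\<And>A. F A \<in> {0..<int p}"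
    and equi: "\<And>xs A t. xs \<in> hemisphere_simplices p q k \<Longrightarrow> A \<noteq> {} \<Longrightarrow> A \<subseteq> set xs
                 \<Longrightarrow> F (rot p t ` A) = shift p t (F A)"
  obtains xs c where "xs \<in> hemisphere_simplices p q k" "length c = Suc k" "sorted_wrt (\<subseteq>) c"
    "\<forall>A\<in>set c. A \<noteq> {} \<and> A \<subseteq> set xs" "distinct_adj (map F c)"
proof (rule ccontr)
  assume contra: "\<not> thesis"
  have "[hemisphere p q k (subdiv (Suc k) (\<lambda>c. theta k (map F c))) = hemisphere p q k (\<lambda>xs. 0)] (mod int p)"
  proof (rule hemisphere_cong_mod)
    fix xs assume xs: "xs \<in> hemisphere_simplices p q k"
    have "[subdiv (Suc k) (\<lambda>c. theta k (map F c)) xs = subdiv (Suc k) (\<lambda>c. 0) xs] (mod int p)"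
    proof (rule subdiv_cong_mod)
      show "length xs = Suc k" using xs by (rule hemisphere_simplices_length)
      fix c :: "('i \<times> nat) set list"
      assume c: "length c = Suc k" "sorted_wrt (\<subseteq>) c" "\<forall>A\<in>set c. A \<noteq> {} \<and> A \<subseteq> set xs"
      then have "theta k (map F c) = 0"
        using that[OF xs c] contra theta_distinct_adj[of "map F c" k] by auto
      then show "[theta k (map F c) = 0] (mod int p)" by simp
    qed
    then show "[subdiv (Suc k) (\<lambda>c. theta k (map F c)) xs = 0] (mod int p)"
      by (simp only: subdiv_zero)
  qed (use assms in simp)
  moreover have "[hemisphere p q k (subdiv (Suc k) (\<lambda>c. theta k (map F c))) = 1] (mod int p)"
    using assms by (intro hemisphere_subdiv_theta) auto
  ultimately have "[0 = 1] (mod int p)"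
    unfolding hemisphere_zero by (blast intro: cong_trans cong_sym)
  then show False using \<open>p > 1\<close> by (auto simp: cong_def)
qed

section \<open>Levels and signs of signed sets\<close>

definition part :: "('a \<times> nat) set \<Rightarrow> nat \<Rightarrow> 'a set" where
  "part Y a = {b. (b, a) \<in> Y}"

definition fib :: "('a \<times> nat) set \<Rightarrow> 'a \<Rightarrow> nat set" where
  "fib Y b = {a. (b, a) \<in> Y}"

definition signed_set :: "nat \<Rightarrow> ('a \<times> nat) set \<Rightarrow> bool" where
  "signed_set p Y \<longleftrightarrow> finite Y \<and> Y \<subseteq> UNIV \<times> {..<p}"

definition min_part :: "nat \<Rightarrow> ('a \<times> nat) set \<Rightarrow> nat" where
  "min_part p Y = Min ((\<lambda>a. card (part Y a)) ` {..<p})"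

definition large_parts :: "nat \<Rightarrow> ('a \<times> nat) set \<Rightarrow> nat set" where
  "large_parts p Y = {a \<in> {..<p}. min_part p Y < card (part Y a)}"

text \<open>In an equitable subfamily every part has at most \<open>min_part p Y + 1\<close>
  elements, so this is the largest total size of one.\<close>

definition level :: "nat \<Rightarrow> ('a \<times> nat) set \<Rightarrow> nat" where
  "level p Y = p * min_part p Y + card (large_parts p Y)"

text \<open>The mean of \<open>J\<close> in \<open>Z\<^sub>p\<close>, meaningful only if \<open>card J\<close> is not divisible by \<open>p\<close>.\<close>

definition set_sign :: "nat \<Rightarrow> nat set \<Rightarrow> int" where
  "set_sign p J = int (\<Sum>J) * (SOME k. [int (card J) * k = 1] (mod int p)) mod int p"

text \<open>For a signed set, exactly the fibres whose size is not divisible by \<open>p\<close>, so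
  that their mean exists when \<open>p\<close> is prime.\<close>

definition free_at :: "nat \<Rightarrow> ('a \<times> nat) set \<Rightarrow> 'a \<Rightarrow> bool" where
  "free_at p Y b \<longleftrightarrow> fib Y b \<noteq> {} \<and> fib Y b \<noteq> {..<p}"

text \<open>The set of those \<open>b\<close> with \<open>free_at p Y b\<close> is invariant under rotation, so \<open>SOME\<close> picks
  the same \<open>b\<close> on a whole orbit.\<close>

definition sign :: "nat \<Rightarrow> ('a \<times> nat) set \<Rightarrow> int" where
  "sign p Y = set_sign p (if large_parts p Y \<noteq> {} then large_parts p Y
                          else fib Y (SOME b. free_at p Y b))"

section \<open>Equivariance of signs under rotation\<close>

lemma bij_betw_shift:
  assumes "p > (0::nat)"
  shows "bij_betw (\<lambda>a. (a + t) mod p) {..<p} {..<p}"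
proof -
  have inj: "inj_on (\<lambda>a. (a + t) mod p) {..<p}"
  proof (rule inj_onI)
    fix a b assume *: "a \<in> {..<p}" "b \<in> {..<p}" "(a + t) mod p = (b + t) mod p"
    then have "[a + t = b + t] (mod p)" by (simp add: cong_def)
    then have "[a = b] (mod p)" by (simp only: cong_add_rcancel_nat)
    then show "a = b" using * by (simp add: cong_less_modulus_unique_nat)
  qed
  moreover have "(\<lambda>a. (a + t) mod p) ` {..<p} = {..<p}"
    using assms by (intro card_subset_eq) (auto simp: card_image[OF inj])
  ultimately show ?thesis by (simp add: bij_betw_def)
qed

text \<open>Translation by \<open>t\<close> adds \<open>t * card J\<close> to the sum modulo
  \<open>p\<close>, hence \<open>t\<close> to the mean. Primality of \<open>p\<close> makes
  \<open>card J\<close> invertible.\<close>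

lemma set_sign_shift:
  assumes "prime p" "J \<subseteq> {..<p}" "J \<noteq> {}" "J \<noteq> {..<p}"
  shows "set_sign p ((\<lambda>a. (a + t) mod p) ` J) = shift p t (set_sign p J)"
proof -
  let ?r = "\<lambda>a. (a + t) mod p"
  have p: "p > 0" using assms(1) by (rule prime_gt_0_nat)
  have fin: "finite J" using assms(2) finite_subset by blast
  have "card J < p"
    using assms psubset_card_mono[of "{..<p}" J] by auto
  moreover have "card J > 0" using fin assms(3) by (simp add: card_gt_0_iff)
  ultimately have "coprime (card J) p"
    using \<open>prime p\<close> by (metis coprime_commute nat_dvd_not_less prime_imp_coprime_nat)
  then have "\<exists>k. [int (card J) * k = 1] (mod int p)"
    by (intro cong_solve_coprime_int) simp
  define k where "k = (SOME k. [int (card J) * k = 1] (mod int p))"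
  have k: "[int (card J) * k = 1] (mod int p)"
    unfolding k_def by (rule someI_ex) fact
  have inj: "inj_on ?r J"
    using bij_betw_shift[OF p, of t] assms(2) by (auto simp: bij_betw_def intro: inj_on_subset)
  have "[\<Sum>(?r ` J) = (\<Sum>a\<in>J. a + t)] (mod p)"
    by (simp add: sum.reindex[OF inj] cong_def mod_sum_eq)
  then have "[int (\<Sum>(?r ` J)) = int (\<Sum>J) + int t * int (card J)] (mod int p)"
    by (simp add: sum.distrib mult.commute flip: cong_int_iff)
  then have "[int (\<Sum>(?r ` J)) * k = (int (\<Sum>J) + int t * int (card J)) * k] (mod int p)"
    by (rule cong_scalar_right)
  also have "(int (\<Sum>J) + int t * int (card J)) * k = int (\<Sum>J) * k + int t * (int (card J) * k)"
    by (simp add: algebra_simps)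
  also have "[\<dots> = int (\<Sum>J) * k + int t * 1] (mod int p)"
    using k by (intro cong_add cong_mult cong_refl)
  finally have "[int (\<Sum>(?r ` J)) * k = int (\<Sum>J) * k + int t] (mod int p)" by simp
  then show ?thesis
    unfolding set_sign_def card_image[OF inj] k_def[symmetric]
    by (simp add: shift_def cong_def mod_simps)
qed

lemma set_sign_range: "p > 0 \<Longrightarrow> set_sign p J \<in> {0..<int p}"
  by (simp add: set_sign_def)

lemma sign_range: "p > 0 \<Longrightarrow> sign p Y \<in> {0..<int p}"
  unfolding sign_def by (rule set_sign_range)

lemma fib_rot: "fib (rot p t ` Y) b = (\<lambda>a. (a + t) mod p) ` fib Y b"
  by (force simp: fib_def rot_def)

lemma fib_subset: "signed_set p Y \<Longrightarrow> fib Y b \<subseteq> {..<p}"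
  by (auto simp: signed_set_def fib_def)

lemma finite_part: "signed_set p Y \<Longrightarrow> finite (part Y a)"
  unfolding part_def signed_set_def
  by (rule finite_subset[of _ "fst ` Y"]) force+

lemma part_rot:
  assumes "signed_set p Y" "a < p"
  shows "part (rot p t ` Y) ((a + t) mod p) = part Y a"
proof -
  have inj: "inj_on (\<lambda>a. (a + t) mod p) {..<p}"
    using bij_betw_shift[of p t] assms(2) by (simp add: bij_betw_def)
  have "a' = a" if "a' < p" "(a + t) mod p = (a' + t) mod p" for a'
    using inj_onD[OF inj that(2)] that assms(2) by auto
  then show ?thesis
    using assms(1) by (force simp: part_def rot_def signed_set_def)
qed

lemma min_part_rot:
  assumes "p > 0" "signed_set p Y"
  shows "min_part p (rot p t ` Y) = min_part p Y"
proof -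
  let ?r = "\<lambda>a. (a + t) mod p"
  have "(\<lambda>a. card (part (rot p t ` Y) a)) ` {..<p} = (\<lambda>a. card (part (rot p t ` Y) a)) ` ?r ` {..<p}"
    using bij_betw_shift[OF assms(1), of t] by (simp add: bij_betw_def)
  also have "\<dots> = (\<lambda>a. card (part Y a)) ` {..<p}"
    unfolding image_image using assms part_rot by (intro image_cong) fastforce+
  finally show ?thesis by (simp add: min_part_def)
qed

lemma large_parts_rot:
  assumes "p > 0" "signed_set p Y"
  shows "large_parts p (rot p t ` Y) = (\<lambda>a. (a + t) mod p) ` large_parts p Y" (is "_ = ?r ` _")
proof -
  have "large_parts p (rot p t ` Y) =
      {a \<in> ?r ` {..<p}. min_part p Y < card (part (rot p t ` Y) a)}"
    using bij_betw_shift[OF assms(1), of t] assms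
    by (simp add: bij_betw_def large_parts_def min_part_rot)
  also have "\<dots> = ?r ` large_parts p Y"
    using part_rot[OF assms(2)] by (auto simp: large_parts_def)
  finally show ?thesis .
qed

lemma min_part_le: "a < p \<Longrightarrow> min_part p Y \<le> card (part Y a)"
  unfolding min_part_def by (intro Min_le) auto

lemma min_part_attained:
  assumes "p > 0"
  obtains a where "a < p" "card (part Y a) = min_part p Y"
  using Min_in[of "(\<lambda>a. card (part Y a)) ` {..<p}"] assms unfolding min_part_def by fastforce

lemma large_parts_psubset:
  assumes "p > 0"
  shows "large_parts p Y \<subset> {..<p}"
proof -
  obtain a where "a < p" "card (part Y a) = min_part p Y"
    using assms by (rule min_part_attained)
  then have "a \<in> {..<p} - large_parts p Y" by (simp add: large_parts_def)
  then show ?thesis by (auto simp: large_parts_def)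
qed

lemma card_large_parts: "p > 0 \<Longrightarrow> card (large_parts p Y) < p"
  using psubset_card_mono[OF _ large_parts_psubset, of p Y] by simp

lemma free_at_rot:
  assumes "p > 0" "signed_set p Y"
  shows "free_at p (rot p t ` Y) b \<longleftrightarrow> free_at p Y b"
proof -
  let ?r = "\<lambda>a. (a + t) mod p"
  have bij: "bij_betw ?r {..<p} {..<p}" using assms(1) by (rule bij_betw_shift)
  then have "?r ` fib Y b = ?r ` {..<p} \<longleftrightarrow> fib Y b = {..<p}"
    using fib_subset[OF assms(2)] by (intro inj_on_image_eq_iff) (auto simp: bij_betw_def)
  with bij show ?thesis by (simp add: free_at_def fib_rot bij_betw_def)
qed

text \<open>The set whose mean is taken rotates along with \<open>Y\<close> and is a nonempty proper
  subset of \<open>{..<p}\<close>: a part of minimum size is never large.\<close>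

lemma sign_rot:
  assumes "prime p" "signed_set p Y" "free_at p Y b"
  shows "sign p (rot p t ` Y) = shift p t (sign p Y)"
proof -
  have p: "p > 0" using assms(1) by (rule prime_gt_0_nat)
  define b0 where "b0 = (SOME b. free_at p Y b)"
  have b0: "free_at p Y b0" unfolding b0_def using assms(3) by (rule someI)
  then have "set_sign p (fib (rot p t ` Y) b0) = shift p t (set_sign p (fib Y b0))"
    unfolding fib_rot using assms(1) fib_subset[OF assms(2)]
    by (intro set_sign_shift) (simp_all add: free_at_def)
  moreover have "set_sign p (large_parts p (rot p t ` Y)) = shift p t (set_sign p (large_parts p Y))"
    if "large_parts p Y \<noteq> {}"
    unfolding large_parts_rot[OF p assms(2)] using assms(1) that large_parts_psubset[OF p, of Y]
    by (intro set_sign_shift) auto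
  moreover have "large_parts p (rot p t ` Y) = {} \<longleftrightarrow> large_parts p Y = {}"
    by (simp add: large_parts_rot[OF p assms(2)])
  ultimately show ?thesis
    unfolding sign_def free_at_rot[OF p assms(2)] b0_def[symmetric] by simp
qed

text \<open>A larger minimum outweighs the large parts, which number less than \<open>p\<close>.
  With equal minima the large parts can only grow, so equal levels force equal large parts; if there
  are none, all parts have the minimum size and the two sets coincide.\<close>

lemma level_mono:
  assumes "p > 0" "signed_set p Y'" "Y \<subseteq> Y'"
  shows "level p Y \<le> level p Y'"
    and "level p Y = level p Y' \<Longrightarrow> sign p Y = sign p Y'"
proof -
  have Y: "signed_set p Y"
    using assms finite_subset[OF assms(3)] unfolding signed_set_def by blast
  have sub: "part Y a \<subseteq> part Y' a" for a using assms(3) by (auto simp: part_def)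
  have le: "card (part Y a) \<le> card (part Y' a)" for a
    using assms by (intro card_mono sub finite_part)
  obtain a where "a < p" "card (part Y' a) = min_part p Y'"
    using assms(1) by (rule min_part_attained)
  then have "min_part p Y \<le> min_part p Y'"
    using min_part_le[of a p Y] le[of a] by simp
  then consider "min_part p Y < min_part p Y'" | "min_part p Y = min_part p Y'"
    by (auto simp: le_less)
  then have "level p Y \<le> level p Y' \<and> (level p Y = level p Y' \<longrightarrow> sign p Y = sign p Y')"
  proof cases
    case 1
    have "level p Y < p * Suc (min_part p Y)"
      using card_large_parts[OF assms(1), of Y] by (simp add: level_def)
    also have "\<dots> \<le> p * min_part p Y'" using 1 by (intro mult_le_mono2) simp
    also have "\<dots> \<le> level p Y'" by (simp add: level_def)
    finally show ?thesis by simp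
  next
    case 2
    have J: "large_parts p Y \<subseteq> large_parts p Y'"
    proof
      fix a assume "a \<in> large_parts p Y"
      then show "a \<in> large_parts p Y'"
        using le[of a] 2 by (simp add: large_parts_def)
    qed
    have fin: "finite (large_parts p Y')" by (simp add: large_parts_def)
    have "sign p Y = sign p Y'" if "level p Y = level p Y'"
    proof -
      have "card (large_parts p Y) = card (large_parts p Y')"
        using that 2 by (simp add: level_def)
      then have eq: "large_parts p Y = large_parts p Y'"
        using J fin by (intro card_subset_eq)
      show ?thesis
      proof (cases "large_parts p Y = {}")
        case True
        have "part Y a = part Y' a" if "a < p" for a
        proof (rule card_subset_eq[OF finite_part[OF assms(2)] sub])
          have "a \<notin> large_parts p Y'"
            using True eq by simp
          then have "card (part Y' a) \<le> min_part p Y'"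
            using that by (simp add: large_parts_def)
          then show "card (part Y a) = card (part Y' a)"
            using min_part_le[OF that, of Y] 2 le[of a] by simp
        qed
        moreover have "a < p" if "(b, a) \<in> Y'" for a b
          using that assms(2) by (auto simp: signed_set_def)
        ultimately have "b \<in> part Y a" if "(b, a) \<in> Y'" for a b
          using that by (simp add: part_def)
        with assms(3) have "Y = Y'" by (auto simp: part_def)
        then show ?thesis by simp
      qed (simp add: sign_def eq)
    qed
    then show ?thesis
      using card_mono[OF fin J] 2 by (simp add: level_def)
  qed
  then show "level p Y \<le> level p Y'" "level p Y = level p Y' \<Longrightarrow> sign p Y = sign p Y'"
    by blast+
qed

lemma level_pos:
  assumes "p > 0" "signed_set p Y" "Y \<noteq> {}"
  shows "level p Y > 0"
proof -
  obtain b a where ba: "(b, a) \<in> Y" using assms(3) by auto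
  have "card (part Y a) > 0"
    using ba finite_part[OF assms(2)] by (auto simp: part_def card_gt_0_iff)
  moreover have "a < p" using ba assms(2) by (auto simp: signed_set_def)
  ultimately have "min_part p Y > 0 \<or> a \<in> large_parts p Y" by (auto simp: large_parts_def)
  moreover have "finite (large_parts p Y)" by (simp add: large_parts_def)
  ultimately show ?thesis using assms(1) by (auto simp: level_def card_gt_0_iff)
qed

text \<open>Division of \<open>m\<close> by \<open>p\<close> gives the common size of the chosen
  subsets, and the remainder the number of subsets with one element more.\<close>

lemma equitable_selection:
  assumes "p > 0" "signed_set p Y" "m \<le> level p Y"
  obtains Z where "\<And>a. a < p \<Longrightarrow> Z a \<subseteq> part Y a" "(\<Sum>a<p. card (Z a)) = m"
    "\<And>a b. a < p \<Longrightarrow> b < p \<Longrightarrow> card (Z a) \<le> card (Z b) + 1"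
proof -
  define k where "k = m div p"
  define r where "r = m mod p"
  have m: "m = p * k + r" "r < p" using assms(1) by (simp_all add: k_def r_def)
  have "p * k < p * Suc (min_part p Y)"
    using m assms(3) card_large_parts[OF assms(1), of Y] by (simp add: level_def)
  then have k: "k \<le> min_part p Y" unfolding mult_less_cancel1 by simp
  \<comment> \<open>The parts that can spare an element beyond \<open>k\<close>: all of them, unless
    \<open>k\<close> is already the minimum.\<close>
  define J where "J = (if k = min_part p Y then large_parts p Y else {..<p})"
  have "r \<le> card J"
    using m assms(3) by (auto simp: J_def level_def)
  then obtain R where R: "R \<subseteq> J" "card R = r" by (rule obtain_subset_with_card_n)
  have Rp: "R \<subseteq> {..<p}" using R by (auto simp: J_def large_parts_def split: if_splits)
  define sz where "sz a = (if a \<in> R then Suc k else k)" for a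
  have "sz a \<le> card (part Y a)" if "a < p" for a
    using min_part_le[OF that, of Y] k R(1)
    by (auto simp: sz_def J_def large_parts_def split: if_splits)
  then have "\<exists>Z. Z \<subseteq> part Y a \<and> card Z = sz a" if "a < p" for a
    using that obtain_subset_with_card_n[of "sz a" "part Y a"] by metis
  then obtain Z where Z: "\<And>a. a < p \<Longrightarrow> Z a \<subseteq> part Y a \<and> card (Z a) = sz a"
    by metis
  show thesis
  proof (rule that[of Z])
    have "(\<Sum>a<p. card (Z a)) = (\<Sum>a<p. k + of_bool (a \<in> R))"
      using Z by (intro sum.cong) (auto simp: sz_def)
    also have "\<dots> = p * k + card R"
      using Rp by (simp add: sum.distrib Int_absorb1 flip: Int_def)
    finally show "(\<Sum>a<p. card (Z a)) = m" using m R by simp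
  qed (use Z in \<open>auto simp: sz_def\<close>)
qed

lemma s_disjoint_parts:
  assumes "A \<subseteq> V \<times> {..<p}" "\<And>i. i \<in> V \<Longrightarrow> card (fib A i) \<le> s i"
    and "\<And>a. a < p \<Longrightarrow> Z a \<subseteq> part A a"
  shows "s_disjoint p V s (image_mset Z (mset_set {..<p}))"
proof -
  have "size {#N \<in># image_mset Z (mset_set {..<p}). i \<in> N#} \<le> s i" if "i \<in> V" for i
  proof -
    have "size {#N \<in># image_mset Z (mset_set {..<p}). i \<in> N#} = card {a \<in> {..<p}. i \<in> Z a}"
      by (simp add: filter_mset_image_mset)
    also have "\<dots> \<le> card (fib A i)"
    proof (rule card_mono)
      show "finite (fib A i)"
        by (rule finite_subset[of _ "{..<p}"]) (use assms(1) in \<open>auto simp: fib_def\<close>)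
      show "{a \<in> {..<p}. i \<in> Z a} \<subseteq> fib A i"
        using assms(3) by (auto simp: fib_def part_def)
    qed
    finally show ?thesis using assms(2)[OF that] by linarith
  qed
  moreover have "Z a \<subseteq> V" if "a < p" for a
    using assms(1) assms(3)[OF that] by (auto simp: part_def)
  ultimately show ?thesis by (auto simp: s_disjoint_def)
qed

lemma sum_card_mset:
  assumes "finite V" "\<forall>N\<in>#M. N \<subseteq> V"
  shows "(\<Sum>N\<in>#M. card N) = (\<Sum>i\<in>V. size {#N \<in># M. i \<in> N#})"
  using assms(2)
proof (induction M)
  case (add N M)
  have "(\<Sum>i\<in>V. size {#N' \<in># add_mset N M. i \<in> N'#}) = (\<Sum>i\<in>V. of_bool (i \<in> N) + size {#N' \<in># M. i \<in> N'#})"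
    by (intro sum.cong) auto
  also have "\<dots> = card N + (\<Sum>i\<in>V. size {#N \<in># M. i \<in> N#})"
    using add.prems assms(1) by (simp add: sum.distrib Int_absorb1 flip: Int_def)
  finally show ?case using add.IH add.prems by simp
qed simp

section \<open>Colours of edges\<close>

text \<open>Again a signed set, now over the colours, so that \<open>level\<close> and
  \<open>sign\<close> apply to it as well.\<close>

definition colours :: "nat \<Rightarrow> 'a set set \<Rightarrow> ('a set \<Rightarrow> 'c) \<Rightarrow> ('a \<times> nat) set \<Rightarrow> ('c \<times> nat) set" where
  "colours p E c A = {(c e, a) | e a. e \<in> E \<and> a < p \<and> e \<subseteq> part A a}"

definition admissible :: "nat \<Rightarrow> 'a set \<Rightarrow> ('a \<Rightarrow> nat) \<Rightarrow> ('a \<times> nat) set \<Rightarrow> bool" where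
  "admissible p V s A \<longleftrightarrow> A \<subseteq> V \<times> {..<p} \<and> (\<forall>i\<in>V. card (fib A i) \<le> s i)"

lemma admissible_signed_set: "finite V \<Longrightarrow> admissible p V s A \<Longrightarrow> signed_set p A"
  unfolding admissible_def signed_set_def
  by (meson finite_SigmaI finite_lessThan finite_subset subset_UNIV Sigma_mono order_trans order_refl)

lemma admissible_subset:
  assumes "finite V" "admissible p V s B" "A \<subseteq> B"
  shows "admissible p V s A"
proof -
  have "card (fib A i) \<le> card (fib B i)" for i
  proof (rule card_mono)
    show "finite (fib B i)"
      using fib_subset[OF admissible_signed_set[OF assms(1,2)]] finite_subset by blast
    show "fib A i \<subseteq> fib B i" using assms(3) by (auto simp: fib_def)
  qed
  then show ?thesis
    using assms(2,3) by (fastforce simp: admissible_def intro: order_trans)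
qed

lemma KG_edgeI:
  assumes "admissible p V s A" "\<And>a. a < p \<Longrightarrow> e a \<in> E" "\<And>a. a < p \<Longrightarrow> e a \<subseteq> part A a"
  shows "image_mset e (mset_set {..<p}) \<in> snd (KG p s (V, E))"
  using assms s_disjoint_parts[of A V p s e] by (auto simp: KG_def admissible_def)

lemma signed_set_colours:
  assumes "finite E"
  shows "signed_set p (colours p E c A)"
  unfolding signed_set_def
proof
  show "finite (colours p E c A)"
    by (rule finite_subset[of _ "c ` E \<times> {..<p}"]) (use assms in \<open>auto simp: colours_def\<close>)
qed (auto simp: colours_def)

lemma colours_mono: "A \<subseteq> B \<Longrightarrow> colours p E c A \<subseteq> colours p E c B"
  by (fastforce simp: colours_def part_def)

lemma colours_rot:
  assumes "p > 0" "signed_set p A"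
  shows "colours p E c (rot p t ` A) = rot p t ` colours p E c A"
proof -
  let ?r = "\<lambda>a. (a + t) mod p"
  have "colours p E c (rot p t ` A) = {(c e, ?r a) | e a. e \<in> E \<and> a < p \<and> e \<subseteq> part (rot p t ` A) (?r a)}"
    (is "?L = ?R")
  proof
    show "?L \<subseteq> ?R"
    proof
      fix v assume "v \<in> ?L"
      then obtain e b where v: "v = (c e, b)" "e \<in> E" "b < p" "e \<subseteq> part (rot p t ` A) b"
        by (auto simp: colours_def)
      then have "b \<in> ?r ` {..<p}"
        using bij_betw_shift[OF assms(1), of t] by (simp add: bij_betw_def)
      then show "v \<in> ?R" using v by auto
    qed
    show "?R \<subseteq> ?L" using assms(1) by (auto simp: colours_def)
  qed
  also have "\<dots> = {(c e, ?r a) | e a. e \<in> E \<and> a < p \<and> e \<subseteq> part A a}"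
    using part_rot[OF assms(2)] by fastforce
  also have "\<dots> = rot p t ` colours p E c A"
    by (force simp: colours_def rot_def)
  finally show ?thesis .
qed

text \<open>A colour present at every sign would yield one edge of that colour in each part,
  together a monochromatic edge of \<open>KG\<close>.\<close>

lemma fib_colours_neq:
  assumes "admissible p V s A" "proper_coloring (KG p s (V, E)) c"
  shows "fib (colours p E c A) b \<noteq> {..<p}"
proof
  assume full: "fib (colours p E c A) b = {..<p}"
  have "\<exists>e. e \<in> E \<and> e \<subseteq> part A a \<and> c e = b" if "a < p" for a
  proof -
    have "a \<in> fib (colours p E c A) b" using full that by simp
    then show ?thesis by (auto simp: fib_def colours_def)
  qed
  then obtain e where e: "\<And>a. a < p \<Longrightarrow> e a \<in> E \<and> e a \<subseteq> part A a \<and> c (e a) = b"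
    by metis
  then have "image_mset e (mset_set {..<p}) \<in> snd (KG p s (V, E))"
    by (intro KG_edgeI[OF assms(1)]) auto
  then have "\<not> (\<forall>v\<in>#image_mset e (mset_set {..<p}). c v = b)"
    using assms(2) unfolding proper_coloring_def by blast
  then show False using e by auto
qed

text \<open>\<open>q\<close> runs through a list in which each i occurs \<open>s i\<close> times, so
  a simplex of the join has at most \<open>s i\<close> signs at i.\<close>

lemma admissible_hemisphere_simplices:
  assumes "finite V"
  obtains q where "\<And>k xs. sum s V = Suc k \<Longrightarrow> xs \<in> hemisphere_simplices p q k \<Longrightarrow> admissible p V s (set xs)"
proof -
  obtain ls where ls: "mset ls = (\<Sum>i\<in>V. replicate_mset (s i) i)"
    using ex_mset by blast
  have len: "length ls = sum s V"
    using arg_cong[OF ls, of size] by (simp add: size_multiset_sum)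
  have cnt: "length (filter (\<lambda>x. x = i) ls) = s i" if "i \<in> V" for i
  proof -
    have "length (filter (\<lambda>x. x = i) ls) = size {#x \<in># mset ls. x = i#}"
      by (metis mset_filter size_mset)
    also have "\<dots> = count (mset ls) i"
      by (simp add: filter_eq_replicate_mset)
    also have "\<dots> = s i"
      using that assms by (simp add: ls count_sum if_distrib sum.delta cong: if_cong)
    finally show ?thesis .
  qed
  have set_ls: "set ls \<subseteq> V"
  proof
    fix i assume "i \<in> set ls"
    then have "i \<in># (\<Sum>i\<in>V. replicate_mset (s i) i)" by (simp flip: ls)
    then show "i \<in> V" using assms by (auto simp: set_mset_sum split: if_splits)
  qed
  \<comment> \<open>\<open>rev ls\<close> makes up for the reversed order in
    \<open>hemisphere_simplices\<close>.\<close>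
  have "admissible p V s (set xs)" if "sum s V = Suc k" "xs \<in> hemisphere_simplices p ((!) (rev ls)) k" for k xs
  proof -
    have map_fst: "map fst xs = ls"
      using that len map_nth[of "rev ls"]
      by (simp add: hemisphere_simplices_def rev_map[symmetric] del: upt_Suc)
    have "set xs \<subseteq> V \<times> {..<p}"
    proof
      fix v assume "v \<in> set xs"
      moreover from this have "fst v \<in> set ls" unfolding map_fst[symmetric] by simp
      ultimately show "v \<in> V \<times> {..<p}"
        using set_ls that(2) by (auto simp: mem_Times_iff hemisphere_simplices_def simp del: upt_Suc)
    qed
    moreover have "card (fib (set xs) i) \<le> s i" if "i \<in> V" for i
    proof -
      have "fib (set xs) i = set (map snd (filter (\<lambda>v. fst v = i) xs))"
        by (force simp: fib_def)
      then have "card (fib (set xs) i) \<le> length (filter (\<lambda>v. fst v = i) xs)"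
        using card_length[of "map snd (filter (\<lambda>v. fst v = i) xs)"] by simp
      also have "\<dots> = length (filter (\<lambda>x. x = i) (map fst xs))"
        by (simp add: filter_map o_def)
      finally show ?thesis using cnt[OF that] map_fst by simp
    qed
    ultimately show ?thesis by (simp add: admissible_def)
  qed
  then show thesis by (rule that)
qed

lemma colourful_signed_set:
  assumes p: "prime p" and V: "finite V" and s: "\<And>i. i \<in> V \<Longrightarrow> s i < p"
    and E: "finite E" and c: "proper_coloring (KG p s (V, E)) c"
    and \<alpha>: "\<And>A. admissible p V s A \<Longrightarrow> colours p E c A = {} \<Longrightarrow> level p A \<le> \<alpha>"
  obtains A where "admissible p V s A" "sum s V \<le> \<alpha> + level p (colours p E c A)"
proof (cases "sum s V")
  case 0
  have "admissible p V s {}" by (simp add: admissible_def fib_def)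
  with 0 show thesis by (intro that) auto
next
  case (Suc k)
  have p0: "p > 0" using p by (rule prime_gt_0_nat)
  let ?col = "colours p E c"
  note scol = signed_set_colours[OF E, of p c]
  note sadm = admissible_signed_set[OF V]
  obtain q where q: "\<And>xs. xs \<in> hemisphere_simplices p q k \<Longrightarrow> admissible p V s (set xs)"
    using admissible_hemisphere_simplices[OF V] Suc by metis
  define F where "F A = (if ?col A = {} then sign p A else sign p (?col A))" for A
  define L where "L A = (if ?col A = {} then level p A else \<alpha> + level p (?col A))" for A
  have F_rot: "F (rot p t ` A) = shift p t (F A)" if A: "admissible p V s A" "A \<noteq> {}" for A t
  proof (cases "?col A = {}")
    case True
    \<comment> \<open>Since \<open>s i < p\<close>, no fibre of \<open>A\<close> is full, so every
      vertex occurring in \<open>A\<close> is free.\<close>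
    obtain i a where ia: "(i, a) \<in> A" using A(2) by auto
    then have "i \<in> V" using A(1) by (auto simp: admissible_def)
    then have "card (fib A i) < p" using s A(1) by (fastforce simp: admissible_def)
    then have "fib A i \<noteq> {..<p}" by (metis card_lessThan less_irrefl)
    moreover have "a \<in> fib A i" using ia by (simp add: fib_def)
    ultimately have "free_at p A i" unfolding free_at_def by blast
    then show ?thesis
      using True sign_rot[OF p sadm[OF A(1)]] by (simp add: F_def colours_rot[OF p0 sadm[OF A(1)]])
  next
    case False
    then obtain b a where ba: "(b, a) \<in> ?col A" by auto
    then have "a \<in> fib (?col A) b" by (simp add: fib_def)
    then have "free_at p (?col A) b"
      using fib_colours_neq[OF A(1) c] unfolding free_at_def by blast
    then show ?thesis
      using False sign_rot[OF p scol] by (simp add: F_def colours_rot[OF p0 sadm[OF A(1)]])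
  qed
  have L_less: "L A < L B"
    if "admissible p V s B" "A \<subseteq> B" "F A \<noteq> F B" for A B
  proof -
    have sub: "?col A \<subseteq> ?col B" using that(2) by (rule colours_mono)
    have A: "admissible p V s A" using admissible_subset[OF V] that by blast
    consider "?col A = {}" "?col B = {}" | "?col A = {}" "?col B \<noteq> {}" | "?col A \<noteq> {}" "?col B \<noteq> {}"
      using sub by blast
    then show ?thesis
    proof cases
      case 1
      then show ?thesis
        using level_mono[OF p0 sadm[OF that(1)] that(2)] that(3) by (auto simp: F_def L_def le_less)
    next
      \<comment> \<open>The passage from vertices to colours: \<open>L A\<close> is at most
        \<alpha>, and a nonempty set of colours has positive level.\<close>
      case 2
      then show ?thesis
        using \<alpha>[OF A] level_pos[OF p0 scol, of B] by (auto simp: L_def)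
    next
      case 3
      then show ?thesis
        using level_mono[OF p0 scol sub] that(3) by (auto simp: F_def L_def le_less)
    qed
  qed
  have "F A \<in> {0..<int p}" for A
    using sign_range[OF p0, of A] sign_range[OF p0, of "?col A"] by (simp add: F_def)
  moreover have "F (rot p t ` A) = shift p t (F A)"
    if "xs \<in> hemisphere_simplices p q k" "A \<noteq> {}" "A \<subseteq> set xs" for xs A t
    using F_rot admissible_subset[OF V q] that by blast
  ultimately obtain xs C where xs: "xs \<in> hemisphere_simplices p q k" and C: "length C = Suc k" "sorted_wrt (\<subseteq>) C"
    "\<forall>A\<in>set C. A \<noteq> {} \<and> A \<subseteq> set xs" "distinct_adj (map F C)"
    by (rule equivariant_sign_chain[OF prime_gt_1_nat[OF p]])
  have adm: "admissible p V s (C ! j)" "C ! j \<noteq> {}" if "j \<le> k" for j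
    using C(1,3) that admissible_subset[OF V q[OF xs]] nth_mem[of j C] by auto
  \<comment> \<open>The chain has k + 1 members; the level starts positive and rises at each step,
    so at the last one it is at least \<open>Suc k\<close>, which is \<open>sum s V\<close>.\<close>
  have "j < L (C ! j)" if "j \<le> k" for j
    using that
  proof (induction j)
    case 0
    then show ?case
      using adm[of 0] level_pos[OF p0 sadm[OF adm(1)[of 0]]] level_pos[OF p0 scol] by (simp add: L_def)
  next
    case (Suc j)
    have "F (C ! j) \<noteq> F (C ! Suc j)"
      using C(1,4) Suc.prems by (simp add: distinct_adj_conv_nth)
    moreover have "C ! j \<subseteq> C ! Suc j"
      using C(1,2) Suc.prems by (simp add: sorted_wrt_nth_less)
    ultimately have "L (C ! j) < L (C ! Suc j)"
      using adm Suc.prems by (intro L_less) auto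
    then show ?case using Suc by simp
  qed
  then have "sum s V \<le> L (C ! k)" using Suc by (simp add: Suc_le_eq)
  \<comment> \<open>If the last set has no colours, \<alpha> alone bounds its level.\<close>
  also have "\<dots> \<le> \<alpha> + level p (?col (C ! k))"
    using \<alpha>[OF adm(1)] by (auto simp: L_def intro: trans_le_add1)
  finally show thesis using adm(1) that by blast
qed

section \<open>The set under the maximum in the colorability defect\<close>

definition edgeless_sizes :: "nat \<Rightarrow> ('a \<Rightarrow> nat) \<Rightarrow> 'a hypergraph \<Rightarrow> nat set" where
  "edgeless_sizes p s H = {(\<Sum>N\<in>#M. card N) | M. s_disjoint p (fst H) s M \<and> equitable M \<and>
                  (\<forall>N\<in>#M. snd (induced H N) = {})}"

lemma edgeless_sizes_le:
  assumes "finite V" "m \<in> edgeless_sizes p s (V, E)"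
  shows "m \<le> sum s V"
proof -
  obtain M where M: "m = (\<Sum>N\<in>#M. card N)" "s_disjoint p V s M"
    using assms(2) by (auto simp: edgeless_sizes_def)
  then have "m = (\<Sum>i\<in>V. size {#N \<in># M. i \<in> N#})"
    using sum_card_mset[OF assms(1)] by (simp add: s_disjoint_def)
  also have "\<dots> \<le> sum s V"
    using M(2) by (intro sum_mono) (simp add: s_disjoint_def)
  finally show ?thesis .
qed

text \<open>Supplies the bound \<alpha> of \<open>colourful_signed_set\<close>: subsets of edgeless
  parts are edgeless, so an equitable selection of total size \<open>level p A\<close> competes for
  the maximum.\<close>

lemma level_in_edgeless_sizes:
  assumes "p > 0" "finite V" "admissible p V s A" "colours p E c A = {}"
  shows "level p A \<in> edgeless_sizes p s (V, E)"
proof -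
  obtain Z where Z: "\<And>a. a < p \<Longrightarrow> Z a \<subseteq> part A a" "(\<Sum>a<p. card (Z a)) = level p A"
    "\<And>a b. a < p \<Longrightarrow> b < p \<Longrightarrow> card (Z a) \<le> card (Z b) + 1"
    using equitable_selection[OF assms(1) admissible_signed_set[OF assms(2,3)], of "level p A"] by auto
  have "\<not> e \<subseteq> Z a" if "e \<in> E" "a < p" for e a
  proof
    assume "e \<subseteq> Z a"
    then have "(c e, a) \<in> colours p E c A"
      using Z(1)[OF that(2)] that by (auto simp: colours_def)
    then show False using assms(4) by simp
  qed
  moreover have "s_disjoint p V s (image_mset Z (mset_set {..<p}))"
    using assms(3) Z(1) by (intro s_disjoint_parts[of A]) (auto simp: admissible_def)
  moreover have "(\<Sum>N\<in>#image_mset Z (mset_set {..<p}). card N) = level p A"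
    using Z(2) by (simp add: sum_unfold_sum_mset image_mset.compositionality o_def)
  ultimately show ?thesis
    using Z(3) unfolding edgeless_sizes_def induced_def equitable_def
    by (intro CollectI exI[of _ "image_mset Z (mset_set {..<p})"]) auto
qed

section \<open>Construction of the parts from the selected colours\<close>

theorem theorem2:
  fixes n p :: nat and E :: "nat set set" and s :: "nat \<Rightarrow> nat" and c :: "nat set \<Rightarrow> 'c"
  assumes "is_hypergraph ({1..n}, E)"
    and "prime p"
    and "\<And>i. i \<in> {1..n} \<Longrightarrow> 1 \<le> s i \<and> s i < p"
    and "proper_coloring (KG p s ({1..n}, E)) c"
  shows "\<exists>K V. subhypergraph K (KG p s ({1..n}, E)) \<and>
           multi_partition p s (fst K) V \<and>
           int (\<Sum>j\<in>{1..p}. card (V j)) = ecd p s ({1..n}, E) \<and>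
           (\<forall>e. (\<forall>j\<in>{1..p}. e j \<in> V j) \<longrightarrow>
                {#e j. j \<in># mset_set {1..p}#} \<in> snd (KG p s ({1..n}, E))) \<and>
           (\<forall>i\<in>{1..p}. \<forall>j\<in>{1..p}. \<bar>int (card (V i)) - int (card (V j))\<bar> \<le> 1) \<and>
           (\<forall>j\<in>{1..p}. inj_on c (V j))"
proof -
  let ?X = "{1..n}"
  let ?S = "edgeless_sizes p s (?X, E)"
  have p0: "p > 0" using assms(2) by (rule prime_gt_0_nat)
  have E: "\<And>e. e \<in> E \<Longrightarrow> e \<noteq> {} \<and> e \<subseteq> ?X" using assms(1) by (auto simp: is_hypergraph_def)
  have finE: "finite E" by (rule finite_subset[of _ "Pow ?X"]) (use E in auto)
  have adm0: "admissible p ?X s {}" by (simp add: admissible_def fib_def)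
  have finS: "finite ?S"
    by (rule finite_subset[of _ "{..sum s ?X}"]) (auto dest: edgeless_sizes_le[rotated])
  \<comment> \<open>No edge is empty, so the family of empty sets is edgeless and the maximum is
    over a nonempty set.\<close>
  have "colours p E c {} = {}" using E by (auto simp: colours_def part_def)
  then have "?S \<noteq> {}" using level_in_edgeless_sizes[OF p0 _ adm0] by blast
  \<comment> \<open>This bound lets the difference in \<open>ecd\<close> be taken in the natural
    numbers.\<close>
  then have \<alpha>: "Max ?S \<le> sum s ?X" using Max_in[OF finS] edgeless_sizes_le[of ?X] by simp
  have ecd: "ecd p s (?X, E) = int (sum s ?X - Max ?S)"
    using \<alpha> by (simp add: ecd_def edgeless_sizes_def)
  obtain A where A: "admissible p ?X s A" and "sum s ?X \<le> Max ?S + level p (colours p E c A)"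
  proof (rule colourful_signed_set[OF assms(2) _ _ finE assms(4)])
    show "level p A \<le> Max ?S" if "admissible p ?X s A" "colours p E c A = {}" for A
      using level_in_edgeless_sizes[OF p0 _ that] finS by (intro Max_ge) auto
  qed (use assms(3) in auto)
  then have "sum s ?X - Max ?S \<le> level p (colours p E c A)" by simp
  then obtain Z where Z: "\<And>a. a < p \<Longrightarrow> Z a \<subseteq> part (colours p E c A) a"
    "(\<Sum>a<p. card (Z a)) = sum s ?X - Max ?S"
    "\<And>a b. a < p \<Longrightarrow> b < p \<Longrightarrow> card (Z a) \<le> card (Z b) + 1"
    using equitable_selection[OF p0 signed_set_colours[OF finE]] by metis
  have "\<exists>e. e \<in> E \<and> e \<subseteq> part A a \<and> c e = x" if "a < p" "x \<in> Z a" for a x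
  proof -
    have "(x, a) \<in> colours p E c A"
      using Z(1)[OF that(1)] that(2) by (auto simp: part_def)
    then show ?thesis by (auto simp: colours_def)
  qed
  \<comment> \<open>One edge is chosen per sign and selected colour. As \<open>c\<close> inverts
    \<open>g a\<close>, the choice preserves cardinalities and keeps colours distinct.\<close>
  then obtain g where g: "\<And>a x. a < p \<Longrightarrow> x \<in> Z a \<Longrightarrow> g a x \<in> E \<and> g a x \<subseteq> part A a \<and> c (g a x) = x"
    by metis
  \<comment> \<open>Signs start at 0, indices of parts at 1.\<close>
  define V where "V j = g (j - 1) ` Z (j - 1)" for j
  have pred: "j - 1 < p" if "j \<in> {1..p}" for j using that by (simp, linarith)
  have V: "e \<in> E" "e \<subseteq> part A (j - 1)" if j: "j \<in> {1..p}" and e: "e \<in> V j" for j e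
  proof -
    obtain x where "x \<in> Z (j - 1)" "e = g (j - 1) x" using e by (auto simp: V_def)
    then show "e \<in> E" "e \<subseteq> part A (j - 1)" using g[OF pred[OF j]] by auto
  qed
  have card_V: "card (V j) = card (Z (j - 1))" if "j \<in> {1..p}" for j
    unfolding V_def using g[OF pred[OF that]] by (intro card_image inj_on_inverseI[of _ c]) auto
  have Suc_image: "Suc ` {..<p} = {1..p}"
    by (simp add: lessThan_atLeast0 image_Suc_atLeastLessThan atLeastLessThanSuc_atLeastAtMost)
  let ?W = "\<Union>j\<in>{1..p}. V j"
  \<comment> \<open>The witness has no edges of its own; the edges formed by choices from the parts
    are claimed in \<open>KG\<close> itself.\<close>
  have "subhypergraph (?W, {}) (KG p s (?X, E))"
    using V by (auto simp: subhypergraph_def KG_def)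
  moreover have "multi_partition p s ?W V"
    unfolding multi_partition_def
  proof (intro conjI refl ballI)
    fix e i assume e: "e \<in> ?W" "i \<in> e"
    then have "i \<in> ?X" using V(1) E by blast
    \<comment> \<open>An edge in \<open>V j\<close> lies in the part of sign \<open>j - 1\<close>,
      so each of its points carries that sign, and the fibre over \<open>i\<close> bounds the
      multiplicity.\<close>
    have "card {j \<in> {1..p}. e \<in> V j} \<le> card (Suc ` fib A i)"
    proof (rule card_mono)
      show "finite (Suc ` fib A i)"
        using fib_subset[OF admissible_signed_set[OF _ A], of i] finite_subset by blast
      show "{j \<in> {1..p}. e \<in> V j} \<subseteq> Suc ` fib A i"
      proof
        fix j assume "j \<in> {j \<in> {1..p}. e \<in> V j}"
        then have "j - 1 \<in> fib A i" "j = Suc (j - 1)"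
          using V(2)[of j e] e(2) by (auto simp: fib_def part_def)
        then show "j \<in> Suc ` fib A i" by blast
      qed
    qed
    also have "\<dots> = card (fib A i)" by (simp add: card_image)
    also have "\<dots> \<le> s i" using A \<open>i \<in> ?X\<close> by (simp add: admissible_def)
    finally show "card {j \<in> {1..p}. e \<in> V j} \<le> s i" .
  qed
  moreover have "(\<Sum>j\<in>{1..p}. card (V j)) = (\<Sum>a<p. card (Z a))"
    unfolding Suc_image[symmetric] using card_V by (simp add: sum.reindex Suc_le_eq)
  then have "int (\<Sum>j\<in>{1..p}. card (V j)) = ecd p s (?X, E)"
    using Z(2) ecd by simp
  moreover have "{#e j. j \<in># mset_set {1..p}#} \<in> snd (KG p s (?X, E))"
    if "\<forall>j\<in>{1..p}. e j \<in> V j" for e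
  proof -
    have "{#e j. j \<in># mset_set {1..p}#} = image_mset (\<lambda>a. e (Suc a)) (mset_set {..<p})"
      unfolding Suc_image[symmetric]
      by (simp add: image_mset.compositionality o_def flip: image_mset_mset_set)
    also have "\<dots> \<in> snd (KG p s (?X, E))"
    proof (rule KG_edgeI[OF A])
      fix a assume "a < p"
      then have "Suc a \<in> {1..p}" by simp
      then show "e (Suc a) \<in> E" "e (Suc a) \<subseteq> part A a"
        using V[of "Suc a" "e (Suc a)"] that by auto
    qed
    finally show ?thesis .
  qed
  moreover have "\<bar>int (card (V i)) - int (card (V j))\<bar> \<le> 1" if "i \<in> {1..p}" "j \<in> {1..p}" for i j
    using Z(3)[OF pred[OF that(1)] pred[OF that(2)]] Z(3)[OF pred[OF that(2)] pred[OF that(1)]] that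
    by (simp add: card_V)
  moreover have "inj_on c (V j)" if "j \<in> {1..p}" for j
    unfolding V_def using g[OF pred[OF that]] by (intro inj_onI) auto
  ultimately show ?thesis
    by (intro exI[of _ "(?W, {})"] exI[of _ V]) simp
qed

end
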